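(* Let $A>0$, $B>0$, $k\in\mathbb R\setminus\{0\}$, and let $\chi_0\in\mathbb C\setminus\{0,k,-k\}$ be an effective double branch point, i.e. $\Lambda'(\chi_0)=0$ and $\Lambda''(\chi_0)\ne0$. Set $\mu_0=\Lambda(\chi_0)$. Then $\chi_0\in\mathbb R$ if and only if $\mu_0\in\mathbb R$.
   Context: For $\chi\in\mathbb C\setminus\{0,k,-k\}$, $$\Lambda(\chi)=\frac1\chi\left[2-k^2\left(\frac{A}{\chi+k}+\frac{B}{\chi-k}\right)\right].$$ *)

theory Defs
  imports "HOL-Analysis.Analysis"
begin

(* A total function on the complex numbers; only its values off {0, k, -k} are
   meaningful, because division by zero returns 0. *)
definition Lambda :: "real \<Rightarrow> real \<Rightarrow> real \<Rightarrow> complex \<Rightarrow> complex" where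
  "Lambda A B k z =
     (1 / z) * (2 - (of_real k)\<^sup>2 *
        (of_real A / (z + of_real k) + of_real B / (z - of_real k)))"

definition effective_double_branch_point :: "real \<Rightarrow> real \<Rightarrow> real \<Rightarrow> complex \<Rightarrow> bool" where
  "effective_double_branch_point A B k z\<^sub>0 \<longleftrightarrow>
     z\<^sub>0 \<notin> {0, of_real k, - of_real k} \<and>
     deriv (Lambda A B k) z\<^sub>0 = 0 \<and>
     deriv (deriv (Lambda A B k)) z\<^sub>0 \<noteq> 0"

end

theory Submission
  imports Defs
begin

text \<open>
  Clearing denominators, a critical point of \<open>\<Lambda>\<close> with value \<open>\<mu>\<close> is a multiple root of
  \<open>\<mu> \<chi> (\<chi>\<^sup>2 - k\<^sup>2) - 2 (\<chi>\<^sup>2 - k\<^sup>2) + k\<^sup>2 (A (\<chi> - k) + B (\<chi> + k))\<close>, a polynomial of degree at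
  most three whose \<open>\<chi>\<^sup>2\<close>-coefficient is \<open>-2\<close>. If \<open>\<mu>\<close> is real and \<open>\<chi>\<close> is not, then the complex
  conjugate of \<open>\<chi>\<close> is a second multiple root, which the degree does not allow.
\<close>

text \<open>The conjugate-root argument is carried out on real and imaginary parts, so that
  \<open>a = 0\<close>, the case of a vanishing critical value, needs no separate treatment. With
  \<open>a = 0\<close>, the condition \<open>b \<noteq> 0\<close> rules out the zero
  polynomial.\<close>

lemma real_cubic_multiple_root_real:
  fixes a b c d :: real and z :: complex
  assumes root: "of_real a * z ^ 3 + of_real b * z\<^sup>2 + of_real c * z + of_real d = 0"
    and deriv_root: "3 * of_real a * z\<^sup>2 + 2 * of_real b * z + of_real c = 0"
    and "b \<noteq> 0"
  shows "z \<in> \<real>"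
proof (rule ccontr)
  assume "z \<notin> \<real>"
  define x y where "x = Re z" and "y = Im z"
  have z: "z = Complex x y"
    by (simp add: x_def y_def)
  have "y \<noteq> 0"
    using \<open>z \<notin> \<real>\<close> by (simp add: y_def complex_is_Real_iff)
  have "y * (a * (3 * x\<^sup>2 - y\<^sup>2) + 2 * b * x + c) = 0"
    using arg_cong[OF root, of Im]
    by (simp add: z power2_eq_square power3_eq_cube algebra_simps)
  then have Im_root: "a * (3 * x\<^sup>2 - y\<^sup>2) + 2 * b * x + c = 0"
    using \<open>y \<noteq> 0\<close> by simp
  have Re_deriv: "3 * a * (x\<^sup>2 - y\<^sup>2) + 2 * b * x + c = 0"
    using arg_cong[OF deriv_root, of Re]
    by (simp add: z power2_eq_square algebra_simps)
  have "y * (3 * a * x + b) = 0"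
    using arg_cong[OF deriv_root, of Im]
    by (simp add: z power2_eq_square algebra_simps)
  then have Im_deriv: "3 * a * x + b = 0"
    using \<open>y \<noteq> 0\<close> by simp
  \<comment> \<open>The left-hand sides of \<open>Im_root\<close> and \<open>Re_deriv\<close> differ
    by \<open>2 * a * y\<^sup>2\<close>. Hence \<open>a = 0\<close>, and \<open>Im_deriv\<close>
    then forces \<open>b = 0\<close>.\<close>
  have "a * y\<^sup>2 = 0"
    using Im_root Re_deriv by (simp add: algebra_simps)
  then show False
    using Im_deriv \<open>y \<noteq> 0\<close> \<open>b \<noteq> 0\<close> by simp
qed

lemma Lambda_mult_denominator:
  assumes "z \<notin> {0, of_real k, - of_real k}"
  shows "Lambda A B k z * (z * (z\<^sup>2 - (of_real k)\<^sup>2)) =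
    2 * (z\<^sup>2 - (of_real k)\<^sup>2) -
    (of_real k)\<^sup>2 * (of_real A * (z - of_real k) + of_real B * (z + of_real k))"
proof -
  have "z \<noteq> 0" "z + of_real k \<noteq> 0" "z - of_real k \<noteq> 0"
    using assms by (auto simp: add_eq_0_iff2)
  then show ?thesis
    unfolding Lambda_def
    by (simp add: divide_simps) (simp add: power2_eq_square algebra_simps)
qed

lemma Lambda_field_differentiable:
  assumes "z \<notin> {0, of_real k, - of_real k}"
  shows "Lambda A B k field_differentiable at z"
proof -
  have "z \<noteq> 0" "z + of_real k \<noteq> 0" "z - of_real k \<noteq> 0"
    using assms by (auto simp: add_eq_0_iff2)
  then show ?thesis
    unfolding Lambda_def by (intro derivative_intros) auto
qed

text \<open>Differentiate the identity with cleared denominators: since the derivative of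
  \<open>Lambda\<close> vanishes at \<open>z\<close>, the product rule leaves only its value times
  the derivative of the denominator.\<close>

lemma Lambda_critical_point:
  assumes z: "z \<notin> {0, of_real k, - of_real k}"
    and crit: "deriv (Lambda A B k) z = 0"
  shows "Lambda A B k z * (3 * z\<^sup>2 - (of_real k)\<^sup>2) =
    4 * z - (of_real k)\<^sup>2 * (of_real A + of_real B)"
proof -
  let ?P = "\<lambda>z. 2 * (z\<^sup>2 - (of_real k)\<^sup>2) -
    (of_real k)\<^sup>2 * (of_real A * (z - of_real k) + of_real B * (z + of_real k))"
  have "(Lambda A B k has_field_derivative 0) (at z)"
    using Lambda_field_differentiable[OF z] crit by (metis DERIV_deriv_iff_field_differentiable)
  then have "((\<lambda>w. Lambda A B k w * (w * (w\<^sup>2 - (of_real k)\<^sup>2))) has_field_derivative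
      Lambda A B k z * (3 * z\<^sup>2 - (of_real k)\<^sup>2)) (at z)"
    by (auto intro!: derivative_eq_intros simp: power2_eq_square algebra_simps)
  \<comment> \<open>The identity may fail at the three excluded points, where the left side is 0; it
    holds on their complement, an open set containing \<open>z\<close>, which suffices for the
    derivative.\<close>
  then have "(?P has_field_derivative Lambda A B k z * (3 * z\<^sup>2 - (of_real k)\<^sup>2)) (at z)"
    by (rule has_field_derivative_transform_within_open[where S = "- {0, of_real k, - of_real k}"])
      (use z Lambda_mult_denominator in \<open>auto intro!: open_Compl finite_imp_closed\<close>)
  moreover have "(?P has_field_derivative
      4 * z - (of_real k)\<^sup>2 * (of_real A + of_real B)) (at z)"
    by (auto intro!: derivative_eq_intros)
  ultimately show ?thesis
    by (rule DERIV_unique)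
qed

theorem proposition10:
  fixes A B k :: real and z\<^sub>0 \<mu>\<^sub>0 :: complex
  assumes "A > 0" and "B > 0" and "k \<noteq> 0"
    and "effective_double_branch_point A B k z\<^sub>0"
    and "\<mu>\<^sub>0 = Lambda A B k z\<^sub>0"
  shows "z\<^sub>0 \<in> \<real> \<longleftrightarrow> \<mu>\<^sub>0 \<in> \<real>"
proof
  assume "z\<^sub>0 \<in> \<real>"
  then show "\<mu>\<^sub>0 \<in> \<real>"
    unfolding assms(5) Lambda_def by simp
next
  assume "\<mu>\<^sub>0 \<in> \<real>"
  then obtain m :: real where m: "Lambda A B k z\<^sub>0 = of_real m"
    using assms(5) by (auto elim: Reals_cases)
  have z: "z\<^sub>0 \<notin> {0, of_real k, - of_real k}" and crit: "deriv (Lambda A B k) z\<^sub>0 = 0"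
    using assms(4) by (auto simp: effective_double_branch_point_def)
  show "z\<^sub>0 \<in> \<real>"
  proof (rule real_cubic_multiple_root_real)
    \<comment> \<open>These are the coefficients of the cleared equation collected by powers of
      \<open>z\<^sub>0\<close>; all are real because \<open>m\<close> is.\<close>
    show "of_real m * z\<^sub>0 ^ 3 + of_real (- 2) * z\<^sub>0\<^sup>2 +
        of_real (k\<^sup>2 * (A + B) - m * k\<^sup>2) * z\<^sub>0 + of_real (2 * k\<^sup>2 + k ^ 3 * (B - A)) = 0"
      using Lambda_mult_denominator[OF z, of A B] unfolding m
      by (simp add: power2_eq_square power3_eq_cube algebra_simps)
    show "3 * of_real m * z\<^sub>0\<^sup>2 + 2 * of_real (- 2) * z\<^sub>0 +
        of_real (k\<^sup>2 * (A + B) - m * k\<^sup>2) = 0"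
      using Lambda_critical_point[OF z crit] unfolding m
      by (simp add: algebra_simps)
  qed simp
qed

end
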